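(* Let $(E,\tau)$ be a real topological linear space, $\psi:E\to\mathbb{R}$ a seminorm, $K, A\subseteq E$ nontrivial, convex cones with normlike-bases $B_K$ and $B_A$ (with respect to $\psi$), and let $K$ be $\tau$-solid. Define $S_{-K}:=\mathrm{conv}(-B_K)$ and $S_A^0:=\mathrm{conv}(B_A\cup\{0\})$. Suppose that $S_{-K}$ is $\tau$-solid. Then the following assertions are equivalent: $1^\circ$ $S_A^0\cap\mathrm{int}_\tau\,S_{-K}=\emptyset$. $2^\circ$ $A\cap\mathrm{int}_\tau(-K)=\emptyset$. $3^\circ$ There exists $x^*\in K^+_\tau\setminus\{0\}$ such that $x^*(a)\geq 0>x^*(k)$ for all $a\in A$ and $k\in\mathrm{int}_\tau(-K)$. $4^\circ$ There exists $(x^*,\alpha)\in K_\tau^{a\circ}$ such that $x^*(a)+\alpha\psi(a)\geq 0>x^*(k)+\alpha\psi(k)$ for all $a\in A$ and $k\in\mathrm{int}_\tau(-K)$.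
   Context: $E\neq\{0\}$; $E'$ is the algebraic dual and $E^*=(E,\tau)^*$ the topological dual; $\mathbb{R}_+=[0,\infty)$. A set $K\subseteq E$ is a cone if $0\in K=\mathbb{R}_+\cdot K$; it is nontrivial if $\{0\}\neq K\neq E$; $\ell(K):=K\cap(-K)$ (same notation for cones in $E'$). A seminorm is a sublinear symmetric function $\psi:E\to\mathbb{R}$ (not assumed $\tau$-continuous). A nontrivial cone $K$ has a normlike-base (w.r.t. $\psi$) if $\psi(x)>0$ for all $x\in K\setminus\{0\}$; the normlike-base is then $B_K:=\{x\in K\mid \psi(x)=1\}$. All normlike-bases are taken with respect to the same fixed seminorm $\psi$. A set $\Omega$ is $\tau$-solid if its $\tau$-interior $\mathrm{int}_\tau\,\Omega$ is nonempty. For $\Omega\subseteq E$, $\mathrm{icor}\,\Omega:=\{x\in\Omega\mid \forall v\in \mathrm{aff}(\Omega-\Omega)\ \exists\varepsilon>0:\ x+[0,\varepsilon]\cdot v\subseteq\Omega\}$, where $\mathrm{aff}$ is the affine hull; $\mathrm{conv}$ is the convex hull. $K^+:=\{y'\in E'\mid \forall k\in K:\ y'(k)\geq 0\}$, $K^+_\tau:=K^+\cap E^*$, $K^{a\circ}:=\{(x',\alpha)\in (K^+\setminus\ell(K^+))\times\mathbb{R}_+\mid \forall y\in\mathrm{icor}\,K:\ x'(y)-\alpha\psi(y)>0\}$, and $K_\tau^{a\circ}:=K^{a\circ}\cap(E^*\times\mathbb{R})$. *)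

theory Defs
  imports "HOL-Analysis.Analysis"
begin

text \<open>
  Real topological linear spaces. As usual for this notion, neither a Hausdorff property
  nor local convexity is required.
\<close>

class real_topological_vector = topological_ab_group_add + real_vector +
  assumes tendsto_scaleR_Pair:
    "LIM x (nhds (c::real) \<times>\<^sub>F nhds a). fst x *\<^sub>R snd x :> nhds (c *\<^sub>R a)"

instance real_normed_vector < real_topological_vector
proof
  fix c :: real and a :: 'a
  show "LIM x (nhds c \<times>\<^sub>F nhds a). fst x *\<^sub>R snd x :> nhds (c *\<^sub>R a)"
    by (intro tendsto_scaleR filterlim_fst filterlim_snd)
qed

definition is_seminorm :: "('a::real_vector \<Rightarrow> real) \<Rightarrow> bool" where
  "is_seminorm \<psi> \<longleftrightarrow>
     (\<forall>x y. \<psi> (x + y) \<le> \<psi> x + \<psi> y) \<and>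
     (\<forall>t\<ge>0. \<forall>x. \<psi> (t *\<^sub>R x) = t * \<psi> x) \<and>
     (\<forall>x. \<psi> (- x) = \<psi> x)"

text \<open>The library's \<open>cone\<close> admits the empty set; here a cone contains the origin.\<close>

definition is_cone :: "'a::real_vector set \<Rightarrow> bool" where
  "is_cone K \<longleftrightarrow> 0 \<in> K \<and> K = {t *\<^sub>R x | t x. t \<ge> 0 \<and> x \<in> K}"

definition nontrivial_cone :: "'a::real_vector set \<Rightarrow> bool" where
  "nontrivial_cone K \<longleftrightarrow> is_cone K \<and> K \<noteq> {0} \<and> K \<noteq> UNIV"

text \<open>
  The pointwise negative of a set \<open>K\<close> is \<open>uminus ` K\<close>, since \<open>- K\<close> denotes the complement.
  \<open>lineality\<close> is used both for sets of vectors and for sets of linear functionals.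
\<close>

definition lineality :: "'b::uminus set \<Rightarrow> 'b set" where
  "lineality K = K \<inter> uminus ` K"

definition has_normlike_base :: "('a::real_vector \<Rightarrow> real) \<Rightarrow> 'a set \<Rightarrow> bool" where
  "has_normlike_base \<psi> K \<longleftrightarrow> nontrivial_cone K \<and> (\<forall>x \<in> K - {0}. \<psi> x > 0)"

definition normlike_base :: "('a \<Rightarrow> real) \<Rightarrow> 'a set \<Rightarrow> 'a set" where
  "normlike_base \<psi> K = {x \<in> K. \<psi> x = 1}"

definition solid :: "'a::topological_space set \<Rightarrow> bool" where
  "solid \<Omega> \<longleftrightarrow> interior \<Omega> \<noteq> {}"

text \<open>The intrinsic core, a purely algebraic notion (unlike \<open>rel_interior\<close>).\<close>

definition icor :: "'a::real_vector set \<Rightarrow> 'a set" where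
  "icor \<Omega> = {x \<in> \<Omega>. \<forall>v \<in> affine hull {a - b | a b. a \<in> \<Omega> \<and> b \<in> \<Omega>}.
                 \<exists>\<epsilon>>0. \<forall>t\<in>{0..\<epsilon>}. x + t *\<^sub>R v \<in> \<Omega>}"

definition algebraic_dual :: "('a::real_vector \<Rightarrow> real) set" where
  "algebraic_dual = {f. linear f}"

definition topological_dual :: "('a::real_topological_vector \<Rightarrow> real) set" where
  "topological_dual = {f. linear f \<and> continuous_on UNIV f}"

definition dual_cone :: "'a::real_vector set \<Rightarrow> ('a \<Rightarrow> real) set" where
  "dual_cone K = {f \<in> algebraic_dual. \<forall>k\<in>K. f k \<ge> 0}"

definition top_dual_cone :: "'a::real_topological_vector set \<Rightarrow> ('a \<Rightarrow> real) set" where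
  "top_dual_cone K = dual_cone K \<inter> topological_dual"

definition aug_dual_cone ::
    "('a::real_vector \<Rightarrow> real) \<Rightarrow> 'a set \<Rightarrow> (('a \<Rightarrow> real) \<times> real) set" where
  "aug_dual_cone \<psi> K =
     {(f, \<alpha>) \<in> (dual_cone K - lineality (dual_cone K)) \<times> {0..}.
        \<forall>y \<in> icor K. f y - \<alpha> * \<psi> y > 0}"

definition top_aug_dual_cone ::
    "('a::real_topological_vector \<Rightarrow> real) \<Rightarrow> 'a set \<Rightarrow> (('a \<Rightarrow> real) \<times> real) set" where
  "top_aug_dual_cone \<psi> K = aug_dual_cone \<psi> K \<inter> (topological_dual \<times> UNIV)"

definition S_neg :: "('a::real_vector \<Rightarrow> real) \<Rightarrow> 'a set \<Rightarrow> 'a set" where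
  "S_neg \<psi> K = convex hull (uminus ` normlike_base \<psi> K)"

definition S_zero :: "('a::real_vector \<Rightarrow> real) \<Rightarrow> 'a set \<Rightarrow> 'a set" where
  "S_zero \<psi> A = convex hull (normlike_base \<psi> A \<union> {0})"

end

theory Submission
  imports Defs
begin

text \<open>
  The equivalence of the second and third assertion is a separation theorem, which without local
  convexity is obtained as follows. Let \<open>e\<close> be interior to \<open>K\<close>, so \<open>- e \<notin> A + K\<close>. Extend \<open>A + K\<close> to
  a maximal convex cone \<open>P\<close> that omits \<open>- e\<close>. Maximality forces \<open>P \<union> - P\<close> to be the whole space, so
  \<open>v \<mapsto> sup {t. v - t e \<in> P}\<close> is linear; it is continuous because \<open>e\<close> is interior to \<open>P\<close>. The
  functional found this way gives the fourth assertion with \<open>\<alpha> = 0\<close>.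

  For the first assertion, let \<open>x \<in> A \<inter> int (- K)\<close> and let \<open>s\<close> be interior to \<open>conv (- B\<^sub>K)\<close>. Then
  \<open>x = k + \<epsilon> s\<close> with \<open>k \<in> - K\<close> and small \<open>\<epsilon> > 0\<close>. Dividing by \<open>\<psi> k + \<epsilon>\<close>, which is at least \<open>\<psi> x\<close>
  since \<open>\<psi> \<le> 1\<close> on \<open>conv (- B\<^sub>K)\<close>, writes a positive multiple of \<open>x\<close> as a convex combination of
  \<open>k / \<psi> k\<close> and \<open>s\<close>.
\<close>

section \<open>Topological vector spaces\<close>

lemma tendsto_scaleR_tvs:
  fixes a :: "'a::real_topological_vector"
  assumes "(f \<longlongrightarrow> c) F" and "(g \<longlongrightarrow> a) F"
  shows "((\<lambda>x. f x *\<^sub>R g x) \<longlongrightarrow> c *\<^sub>R a) F"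
  using filterlim_compose[OF tendsto_scaleR_Pair filterlim_Pair[OF assms]] by simp

lemma continuous_on_scaleR_tvs:
  fixes g :: "'b::topological_space \<Rightarrow> 'a::real_topological_vector"
  assumes "continuous_on S f" and "continuous_on S g"
  shows "continuous_on S (\<lambda>x. f x *\<^sub>R g x)"
  using assms by (simp add: continuous_on_def tendsto_scaleR_tvs)

text \<open>As t decreases to 0, x + t v tends to x and so enters the open interior. Most later uses
  of interior points need only this algebraic form.\<close>

lemma interior_absorbing:
  fixes x v :: "'a::real_topological_vector"
  assumes "x \<in> interior S"
  obtains \<epsilon> where "\<epsilon> > 0" and "x + \<epsilon> *\<^sub>R v \<in> S"
proof -
  have "((\<lambda>t::real. x + t *\<^sub>R v) \<longlongrightarrow> x + 0 *\<^sub>R v) (at_right 0)"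
    by (intro tendsto_intros tendsto_scaleR_tvs)
  then have "\<forall>\<^sub>F t in at_right 0. x + t *\<^sub>R v \<in> interior S"
    using assms by (intro topological_tendstoD) auto
  moreover have "\<forall>\<^sub>F t in at_right (0::real). 0 < t"
    by (rule eventually_at_right_less)
  ultimately have "\<forall>\<^sub>F t in at_right 0. 0 < t \<and> x + t *\<^sub>R v \<in> interior S"
    by eventually_elim simp
  then obtain t :: real where "0 < t" and "x + t *\<^sub>R v \<in> interior S"
    using eventually_happens' trivial_limit_at_right_real by blast
  then show thesis
    using that interior_subset by blast
qed

lemma interior_uminus_image:
  fixes S :: "'a::topological_group_add set"
  shows "interior (uminus ` S) = uminus ` interior S"
proof -
  have sub: "uminus ` interior T \<subseteq> interior (uminus ` T)" for T :: "'a set"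
  proof (rule interior_maximal)
    have "open (uminus -` interior T)"
      by (intro open_vimage open_interior continuous_intros)
    moreover have "uminus -` interior T = uminus ` interior T"
      by (force simp: image_iff)
    ultimately show "open (uminus ` interior T)" by simp
  qed (use interior_subset in blast)
  have "uminus ` interior (uminus ` S) \<subseteq> interior S"
    using sub[of "uminus ` S"] by (simp add: image_image)
  then have "interior (uminus ` S) \<subseteq> uminus ` interior S"
    by (force simp: image_iff)
  with sub[of S] show ?thesis by blast
qed

text \<open>Since \<open>w > 0\<close>, the map z \<mapsto> u y + w z has the continuous inverse
  \<open>g\<close>, so the image of the interior is open; convexity keeps it inside
  \<open>S\<close>.\<close>

lemma convex_interior_combination:
  fixes S :: "'a::real_topological_vector set"
  assumes "convex S" "y \<in> S" "s \<in> interior S" "0 \<le> u" "0 < w" "u + w = 1"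
  shows "u *\<^sub>R y + w *\<^sub>R s \<in> interior S"
proof -
  define g where "g z = (1 / w) *\<^sub>R (z - u *\<^sub>R y)" for z
  have "continuous_on UNIV g"
    unfolding g_def by (intro continuous_on_scaleR_tvs continuous_intros)
  then have "open (g -` interior S)"
    by (intro open_vimage) auto
  moreover have "g -` interior S \<subseteq> S"
  proof
    fix z assume "z \<in> g -` interior S"
    then have "g z \<in> S" using interior_subset by auto
    then have "u *\<^sub>R y + w *\<^sub>R g z \<in> S"
      using assms by (intro convexD) auto
    then show "z \<in> S" using assms by (simp add: g_def)
  qed
  moreover have "u *\<^sub>R y + w *\<^sub>R s \<in> g -` interior S"
    using assms by (simp add: g_def)
  ultimately show ?thesis
    by (meson interior_maximal subsetD)
qed

lemma continuous_on_linear_functional: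
  fixes f :: "'a::real_topological_vector \<Rightarrow> real"
  assumes "linear f" "open N" "0 \<in> N" and bound: "\<And>v. v \<in> N \<Longrightarrow> \<bar>f v\<bar> \<le> 1"
  shows "continuous_on UNIV f"
  unfolding continuous_on_def
proof (intro ballI tendstoI)
  fix x :: 'a and r :: real assume "r > 0"
  \<comment> \<open>The factor \<open>2 / r\<close> turns the bound 1 on \<open>N\<close> into r /
    2, which is strictly below r.\<close>
  have "((\<lambda>y. (2 / r) *\<^sub>R (y - x)) \<longlongrightarrow> (2 / r) *\<^sub>R (x - x)) (at x)"
    by (intro tendsto_scaleR_tvs tendsto_intros)
  then have "\<forall>\<^sub>F y in at x. (2 / r) *\<^sub>R (y - x) \<in> N"
    using assms by (intro topological_tendstoD) auto
  then show "\<forall>\<^sub>F y in at x. dist (f y) (f x) < r"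
  proof eventually_elim
    case (elim y)
    have "f ((2 / r) *\<^sub>R (y - x)) = (2 / r) * (f y - f x)"
      using \<open>linear f\<close> by (simp only: linear_scale linear_diff real_scaleR_def)
    then have "\<bar>(2 / r) * (f y - f x)\<bar> \<le> 1"
      using bound[OF elim] by argo
    then have "\<bar>2 / r\<bar> * \<bar>f y - f x\<bar> \<le> 1"
      by (simp only: abs_mult)
    then show ?case
      using \<open>r > 0\<close> by (simp add: dist_real_def field_simps)
  qed
qed

section \<open>Positive functionals on convex cones\<close>

lemma maximal_convex_cone:
  fixes C :: "'a::real_vector set"
  assumes "convex_cone C" "e \<in> C" "- e \<notin> C"
  obtains P where "convex_cone P" "C \<subseteq> P" "- e \<notin> P" "\<And>v. v \<in> P \<or> - v \<in> P"
proof -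
  define F where "F = {P. convex_cone P \<and> C \<subseteq> P \<and> - e \<notin> P}"
  have "\<Union>\<C> \<in> F" if "\<C> \<noteq> {}" and chain: "subset.chain F \<C>" for \<C>
  proof -
    have \<C>: "convex_cone P" "C \<subseteq> P" "- e \<notin> P" if "P \<in> \<C>" for P
      using that chain by (auto simp: subset.chain_def F_def)
    \<comment> \<open>Members of a chain are comparable, so both summands lie in the larger of two
      members and their sum stays there.\<close>
    have "x + y \<in> \<Union>\<C>" if xy: "x \<in> \<Union>\<C>" "y \<in> \<Union>\<C>" for x y
    proof -
      obtain X Y where XY: "X \<in> \<C>" "x \<in> X" "Y \<in> \<C>" "y \<in> Y"
        using xy by blast
      then consider "X \<subseteq> Y" | "Y \<subseteq> X"
        using chain by (metis subset_chain_def)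
      then show ?thesis
        using XY \<C>(1) convex_cone_add by (metis UnionI subsetD)
    qed
    moreover have "0 \<in> \<Union>\<C>"
      using \<open>\<C> \<noteq> {}\<close> \<C>(1) convex_cone_contains_0 by blast
    moreover have "c *\<^sub>R x \<in> \<Union>\<C>" if "x \<in> \<Union>\<C>" "0 \<le> c" for c x
      using that \<C>(1) convex_cone_scaleR by blast
    ultimately have "convex_cone (\<Union>\<C>)"
      by (simp add: convex_cone_iff del: Union_iff)
    then show ?thesis
      using \<open>\<C> \<noteq> {}\<close> \<C>(2,3) by (auto simp: F_def)
  qed
  moreover have "F \<noteq> {}"
    using assms by (auto simp: F_def)
  ultimately obtain P where "P \<in> F" and max: "\<And>Q. Q \<in> F \<Longrightarrow> P \<subseteq> Q \<Longrightarrow> Q = P"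
    using subset_Zorn_nonempty[of F] by metis
  then have P: "convex_cone P" "C \<subseteq> P" "- e \<notin> P"
    by (auto simp: F_def)
  \<comment> \<open>Adjoining the ray of \<open>v\<close> to \<open>P\<close> gives a strictly
    larger convex cone, which by maximality must contain \<open>- e\<close>; the coefficient of
    \<open>v\<close> is positive because \<open>- e \<notin> P\<close>.\<close>
  have ext: "\<exists>p t. p \<in> P \<and> 0 < t \<and> p + t *\<^sub>R v = - e" if "v \<notin> P" for v
  proof -
    define Q where "Q = {p + t *\<^sub>R v | p t. p \<in> P \<and> 0 \<le> t}"
    have QI: "p + t *\<^sub>R v \<in> Q" if "p \<in> P" "0 \<le> t" for p t
      using that by (auto simp: Q_def)
    have "0 \<in> Q"
      using QI[of 0 0] P(1) convex_cone_contains_0 by auto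
    moreover have "x + y \<in> Q" if xy: "x \<in> Q" "y \<in> Q" for x y
    proof -
      obtain p s q t where "x = p + s *\<^sub>R v" "p \<in> P" "0 \<le> s" "y = q + t *\<^sub>R v" "q \<in> P" "0 \<le> t"
        using xy unfolding Q_def by blast
      then show ?thesis
        using QI[of "p + q" "s + t"] P(1) convex_cone_add by (auto simp: algebra_simps)
    qed
    moreover have "c *\<^sub>R x \<in> Q" if x: "x \<in> Q" and "0 \<le> c" for c x
    proof -
      obtain p s where "x = p + s *\<^sub>R v" "p \<in> P" "0 \<le> s"
        using x unfolding Q_def by blast
      then show ?thesis
        using QI[of "c *\<^sub>R p" "c * s"] P(1) convex_cone_scaleR \<open>0 \<le> c\<close>
        by (auto simp: algebra_simps)
    qed
    ultimately have "convex_cone Q"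
      by (simp add: convex_cone_iff)
    moreover have "P \<subseteq> Q"
      using QI[of _ 0] by auto
    moreover have "v \<in> Q"
      using QI[of 0 1] P(1) convex_cone_contains_0 by auto
    ultimately have "- e \<in> Q"
      using max[of Q] P(2) \<open>v \<notin> P\<close> by (auto simp: F_def)
    then obtain p t where "p + t *\<^sub>R v = - e" "p \<in> P" "0 \<le> t"
      by (auto simp: Q_def)
    moreover from this have "t \<noteq> 0"
      using P(3) by auto
    ultimately show ?thesis by (intro exI[of _ p] exI[of _ t]) auto
  qed
  have "v \<in> P \<or> - v \<in> P" for v
  proof (rule ccontr)
    assume "\<not> ?thesis"
    then obtain p s q t where ps: "p \<in> P" "0 < s" "p + s *\<^sub>R v = - e"
      and qt: "q \<in> P" "0 < t" "q + t *\<^sub>R (- v) = - e"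
      using ext[of v] ext[of "- v"] by blast
    \<comment> \<open>The weights t and s cancel the multiples of \<open>v\<close>; dividing by s +
      t then puts \<open>- e\<close> into \<open>P\<close>.\<close>
    have "t *\<^sub>R p + s *\<^sub>R q = t *\<^sub>R (p + s *\<^sub>R v) + s *\<^sub>R (q + t *\<^sub>R (- v))"
      by (simp add: algebra_simps)
    also have "\<dots> = (s + t) *\<^sub>R (- e)"
      unfolding ps(3) qt(3) by (simp add: algebra_simps)
    finally have "(1 / (s + t)) *\<^sub>R (t *\<^sub>R p + s *\<^sub>R q) = - e"
      using ps qt by simp
    moreover have "(1 / (s + t)) *\<^sub>R (t *\<^sub>R p + s *\<^sub>R q) \<in> P"
      using ps qt P(1) by (intro convex_cone_scaleR convex_cone_add) auto
    ultimately show False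
      using P(3) by simp
  qed
  with P show thesis
    using that by blast
qed

text \<open>\<open>P\<close> is the nonnegative cone of a total preorder with order unit
  \<open>e\<close>, so comparing \<open>v\<close> with the multiples of \<open>e\<close> cuts the
  real line, and \<open>f v\<close> is the place of the cut. As \<open>P\<close> need not be closed,
  membership is controlled only strictly on either side of it.\<close>

lemma total_cone_functional:
  fixes P :: "'a::real_vector set"
  assumes P: "convex_cone P" and e: "- e \<notin> P" and total: "\<And>v. v \<in> P \<or> - v \<in> P"
    and absorbing: "\<And>v. \<exists>t. t *\<^sub>R e - v \<in> P"
  shows "\<exists>f :: 'a \<Rightarrow> real. linear f \<and> f e = 1 \<and> (\<forall>v\<in>P. 0 \<le> f v)"
proof -
  define f where "f v = Sup {t. v - t *\<^sub>R e \<in> P}" for v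
  \<comment> \<open>Totality puts \<open>e\<close> in \<open>P\<close>, and a negative multiple of
    \<open>e\<close> in \<open>P\<close> would rescale to \<open>- e\<close>.\<close>
  have ePos: "t *\<^sub>R e \<in> P \<longleftrightarrow> 0 \<le> t" for t
  proof
    assume te: "t *\<^sub>R e \<in> P"
    show "0 \<le> t"
    proof (rule ccontr)
      assume "\<not> 0 \<le> t"
      then have "(1 / - t) *\<^sub>R (t *\<^sub>R e) \<in> P"
        using convex_cone_scaleR[OF P _ te, of "1 / - t"] by simp
      then show False
        using e \<open>\<not> 0 \<le> t\<close> by simp
    qed
  qed (use P e total[of e] in \<open>simp add: convex_cone_scaleR\<close>)
  \<comment> \<open>Adding the two members of \<open>P\<close> eliminates \<open>v\<close> and
    leaves (s - t) e.\<close>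
  have sep: "t \<le> s" if "v - t *\<^sub>R e \<in> P" "s *\<^sub>R e - v \<in> P" for v s t
    using convex_cone_add[OF P that] ePos[of "s - t"] by (simp add: algebra_simps)
  have ne: "{t. v - t *\<^sub>R e \<in> P} \<noteq> {}" for v
  proof -
    obtain t where "t *\<^sub>R e - (- v) \<in> P" using absorbing by blast
    then have "- t \<in> {t. v - t *\<^sub>R e \<in> P}" by (simp add: algebra_simps)
    then show ?thesis by blast
  qed
  have lower: "t \<le> f v" if "v - t *\<^sub>R e \<in> P" for v t
  proof -
    obtain s where "s *\<^sub>R e - v \<in> P" using absorbing by blast
    then have "bdd_above {t. v - t *\<^sub>R e \<in> P}"
      using sep by (intro bdd_aboveI[of _ s]) auto
    then show ?thesis
      unfolding f_def using that by (intro cSup_upper) auto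
  qed
  have upper: "f v \<le> s" if "s *\<^sub>R e - v \<in> P" for v s
    unfolding f_def using ne sep that by (intro cSup_least) auto
  \<comment> \<open>If s e - v were outside \<open>P\<close>, totality would give v - s e \<in>
    \<open>P\<close> and hence s \<le> \<open>f v\<close>.\<close>
  have above: "s *\<^sub>R e - v \<in> P" if "f v < s" for v s
    using total[of "s *\<^sub>R e - v"] lower[of v s] that by auto
  have below: "v - t *\<^sub>R e \<in> P" if "t < f v" for v t
    using total[of "v - t *\<^sub>R e"] upper[of t v] that by auto
  have regroup: "(v - s *\<^sub>R e) + (w - t *\<^sub>R e) = (v + w) - (s + t) *\<^sub>R e"
    and regroup': "(s *\<^sub>R e - v) + (t *\<^sub>R e - w) = (s + t) *\<^sub>R e - (v + w)" for v w s t
    by (simp_all add: algebra_simps)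
  \<comment> \<open>Cuts are added with slack r / 2 on each summand, since only the strict sides of
    a cut are available.\<close>
  have add: "f (v + w) = f v + f w" for v w
  proof (rule antisym)
    show "f (v + w) \<le> f v + f w"
    proof (rule field_le_epsilon)
      fix r :: real assume "0 < r"
      then have "((f v + r / 2) *\<^sub>R e - v) + ((f w + r / 2) *\<^sub>R e - w) \<in> P"
        using above P by (intro convex_cone_add) auto
      moreover have "((f v + r / 2) *\<^sub>R e - v) + ((f w + r / 2) *\<^sub>R e - w)
          = ((f v + r / 2) + (f w + r / 2)) *\<^sub>R e - (v + w)"
        by (rule regroup')
      ultimately have "f (v + w) \<le> (f v + r / 2) + (f w + r / 2)"
        using upper by metis
      then show "f (v + w) \<le> f v + f w + r" by simp
    qed
    show "f v + f w \<le> f (v + w)"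
    proof (rule field_le_epsilon)
      fix r :: real assume "0 < r"
      then have "(v - (f v - r / 2) *\<^sub>R e) + (w - (f w - r / 2) *\<^sub>R e) \<in> P"
        using below P by (intro convex_cone_add) auto
      moreover have "(v - (f v - r / 2) *\<^sub>R e) + (w - (f w - r / 2) *\<^sub>R e)
          = (v + w) - ((f v - r / 2) + (f w - r / 2)) *\<^sub>R e"
        by (rule regroup)
      ultimately have "(f v - r / 2) + (f w - r / 2) \<le> f (v + w)"
        using lower by metis
      then show "f v + f w \<le> f (v + w) + r" by simp
    qed
  qed
  \<comment> \<open>The slack \<open>r / c\<close> becomes r after scaling by c. The reverse
    inequality is this one for \<open>1 / c\<close> at the vector c v.\<close>
  have scale_le: "c * f v \<le> f (c *\<^sub>R v)" if "0 < c" for c v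
  proof (rule field_le_epsilon)
    fix r :: real assume "0 < r"
    then have "c *\<^sub>R (v - (f v - r / c) *\<^sub>R e) \<in> P"
      using below P that by (intro convex_cone_scaleR) auto
    then have "c *\<^sub>R v - (c * f v - r) *\<^sub>R e \<in> P"
      using that by (simp add: scaleR_diff_right right_diff_distrib)
    then show "c * f v \<le> f (c *\<^sub>R v) + r"
      using lower by fastforce
  qed
  have scale_pos: "f (c *\<^sub>R v) = c * f v" if "0 < c" for c v
    using scale_le[OF that, of v] scale_le[of "1 / c" "c *\<^sub>R v"] that
    by (simp add: field_simps)
  have zero: "f 0 = 0"
    using add[of 0 0] by simp
  have neg: "f (- v) = - f v" for v
    using add[of v "- v"] zero by simp
  have "linear f"
  proof (rule linearI)
    fix c :: real and v
    consider "c = 0" | "0 < c" | "0 < - c" by linarith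
    then show "f (c *\<^sub>R v) = c *\<^sub>R f v"
    proof cases
      case 3
      then show ?thesis using scale_pos[of "- c" v] neg[of "c *\<^sub>R v"] by simp
    qed (simp_all add: zero scale_pos)
  qed (rule add)
  \<comment> \<open>Both e - 1 e and 1 e - e are 0, so 1 is at once a lower and an upper bound for
    \<open>f e\<close>.\<close>
  moreover have "0 \<in> P" using P convex_cone_contains_0 by blast
  then have "f e = 1"
    using lower[of e 1] upper[of 1 e] by simp
  moreover have "0 \<le> f v" if "v \<in> P" for v
    using lower[of v 0] that by simp
  ultimately show ?thesis
    by blast
qed

lemma convex_cone_positive_functional:
  fixes C :: "'a::real_topological_vector set"
  assumes "convex_cone C" "e \<in> interior C" "- e \<notin> C"
  shows "\<exists>f :: 'a \<Rightarrow> real. linear f \<and> continuous_on UNIV f \<and> f e = 1 \<and> (\<forall>v\<in>C. 0 \<le> f v)"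
proof -
  have "e \<in> C" using assms interior_subset by blast
  then obtain P where P: "convex_cone P" "C \<subseteq> P" "- e \<notin> P" "\<And>v. v \<in> P \<or> - v \<in> P"
    using maximal_convex_cone[of C e] assms by metis
  \<comment> \<open>Interiority of \<open>e\<close> gives e - r v \<in> \<open>C\<close> for some r
    > 0; dividing by r makes \<open>e\<close> an order unit for \<open>P\<close>.\<close>
  have "\<exists>t. t *\<^sub>R e - v \<in> P" for v
  proof -
    obtain r where r: "r > 0" "e + r *\<^sub>R (- v) \<in> C"
      using interior_absorbing[OF assms(2)] by blast
    then have "(1 / r) *\<^sub>R (e + r *\<^sub>R (- v)) \<in> P"
      using P by (intro convex_cone_scaleR) auto
    then have "(1 / r) *\<^sub>R e - v \<in> P"
      using r by (simp add: scaleR_diff_right)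
    then show ?thesis ..
  qed
  with total_cone_functional[OF P(1,3,4)]
  obtain f :: "'a \<Rightarrow> real" where f: "linear f" "f e = 1" "\<forall>v\<in>P. 0 \<le> f v"
    by metis
  \<comment> \<open>On this symmetric neighbourhood of 0, positivity of \<open>f\<close> at e + v
    and e - v together with \<open>f e = 1\<close> bounds |f v| by 1.\<close>
  define N where "N = (\<lambda>v. e + v) -` interior C \<inter> (\<lambda>v. e - v) -` interior C"
  have "open N"
    unfolding N_def by (intro open_Int open_vimage open_interior continuous_intros)
  moreover have "0 \<in> N" using assms by (simp add: N_def)
  moreover have "\<bar>f v\<bar> \<le> 1" if "v \<in> N" for v
  proof -
    have "e + v \<in> P" "e - v \<in> P"
      using that P(2) interior_subset by (auto simp: N_def)
    then have "0 \<le> f (e + v)" "0 \<le> f (e - v)"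
      using f(3) by blast+
    then show ?thesis
      using f(1,2) by (simp add: linear_add linear_diff)
  qed
  ultimately have "continuous_on UNIV f"
    by (rule continuous_on_linear_functional[OF f(1)])
  moreover have "\<forall>v\<in>C. 0 \<le> f v"
    using f(3) P(2) by blast
  ultimately show ?thesis
    using f(1,2) by blast
qed

section \<open>Convex cones: interior points, intrinsic core and strict positivity\<close>

lemma is_cone_convex_cone:
  assumes "is_cone K" "convex K"
  shows "convex_cone K"
proof -
  have "t *\<^sub>R x \<in> {t *\<^sub>R x | t x. t \<ge> 0 \<and> x \<in> K}" if "0 \<le> t" "x \<in> K" for t x
    using that by blast
  then have "conic K"
    using assms(1) unfolding is_cone_def conic_def by metis
  then show ?thesis
    using assms by (auto simp: convex_cone_def is_cone_def)
qed

text \<open>If 0 were interior, a positive multiple of every vector would lie in \<open>K\<close>,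
  and rescaling would make \<open>K\<close> the whole space.\<close>

lemma cone_zero_notin_interior:
  fixes K :: "'a::real_topological_vector set"
  assumes "convex_cone K" "K \<noteq> UNIV"
  shows "0 \<notin> interior K"
proof
  assume 0: "0 \<in> interior K"
  have "v \<in> K" for v
  proof -
    obtain r where r: "r > 0" "0 + r *\<^sub>R v \<in> K"
      using interior_absorbing[OF 0] by blast
    then have "(1 / r) *\<^sub>R (0 + r *\<^sub>R v) \<in> K"
      using assms by (intro convex_cone_scaleR) auto
    then show ?thesis using r by simp
  qed
  with assms show False by blast
qed

text \<open>The translate of the interior by \<open>y\<close> is open and stays in \<open>K\<close>,
  which is closed under addition.\<close>

lemma cone_add_interior:
  fixes K :: "'a::real_topological_vector set"
  assumes "convex_cone K" "x \<in> interior K" "y \<in> K"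
  shows "x + y \<in> interior K"
proof -
  have "open ((\<lambda>z. z - y) -` interior K)"
    by (intro open_vimage open_interior continuous_intros)
  moreover have "(\<lambda>z. z - y) -` interior K \<subseteq> K"
  proof
    fix z assume "z \<in> (\<lambda>z. z - y) -` interior K"
    then have "z - y \<in> K" using interior_subset by auto
    then have "z - y + y \<in> K" using assms by (intro convex_cone_add)
    then show "z \<in> K" by simp
  qed
  ultimately show ?thesis
    using interior_maximal[of "(\<lambda>z. z - y) -` interior K" K] assms(2) by auto
qed

text \<open>A small step from \<open>x\<close> in direction \<open>- e\<close> stays in
  \<open>K\<close>, so f x \<ge> r f e > 0.\<close>

lemma positive_functional_interior:
  fixes f :: "'a::real_topological_vector \<Rightarrow> real"
  assumes "linear f" "f e > 0" "\<And>v. v \<in> K \<Longrightarrow> 0 \<le> f v" "x \<in> interior K"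
  shows "f x > 0"
proof -
  obtain r where r: "r > 0" "x + r *\<^sub>R (- e) \<in> K"
    using interior_absorbing[OF assms(4)] by blast
  then have "0 \<le> f (x + r *\<^sub>R (- e))"
    using assms(3) by blast
  then have "0 \<le> f x - r * f e"
    using assms(1) by (simp add: linear_diff linear_scale)
  moreover have "r * f e > 0" using r assms(2) by simp
  ultimately show ?thesis by linarith
qed

text \<open>The same step works in the intrinsic core, because 0 - e is a difference of points of
  \<open>K\<close> and thus an admissible direction. This supplies the strict inequality in
  \<open>aug_dual_cone\<close> for \<alpha> = 0.\<close>

lemma positive_functional_icor:
  fixes f :: "'a::real_vector \<Rightarrow> real"
  assumes "linear f" "f e > 0" "e \<in> K" "0 \<in> K" "\<And>v. v \<in> K \<Longrightarrow> 0 \<le> f v" "x \<in> icor K"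
  shows "f x > 0"
proof -
  have "0 - e \<in> affine hull {a - b | a b. a \<in> K \<and> b \<in> K}"
    using assms(3,4) by (intro hull_inc) blast
  then obtain r where r: "r > 0" "\<forall>t\<in>{0..r}. x + t *\<^sub>R (0 - e) \<in> K"
    using assms(6) unfolding icor_def by blast
  then have "0 \<le> f (x + r *\<^sub>R (0 - e))"
    using assms(5) by simp
  then have "0 \<le> f x - r * f e"
    using assms(1) by (simp add: linear_diff linear_scale)
  moreover have "r * f e > 0" using r assms(2) by simp
  ultimately show ?thesis by linarith
qed

section \<open>Seminorms and normlike bases\<close>

lemma seminorm_add: "is_seminorm \<psi> \<Longrightarrow> \<psi> (x + y) \<le> \<psi> x + \<psi> y"
  and seminorm_scaleR: "is_seminorm \<psi> \<Longrightarrow> 0 \<le> t \<Longrightarrow> \<psi> (t *\<^sub>R x) = t * \<psi> x"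
  and seminorm_minus: "is_seminorm \<psi> \<Longrightarrow> \<psi> (- x) = \<psi> x"
  unfolding is_seminorm_def by blast+

lemma S_neg_subset:
  assumes "convex K"
  shows "S_neg \<psi> K \<subseteq> uminus ` K"
  unfolding S_neg_def
  using assms by (intro hull_minimal convex_negations) (auto simp: normlike_base_def)

lemma S_zero_subset:
  assumes "convex A" "0 \<in> A"
  shows "S_zero \<psi> A \<subseteq> A"
  unfolding S_zero_def
  using assms by (intro hull_minimal) (auto simp: normlike_base_def)

text \<open>The sublevel set of \<psi> at 1 is convex and contains the negated base, hence also its
  convex hull.\<close>

lemma seminorm_S_neg_le_1:
  assumes "is_seminorm \<psi>" "s \<in> S_neg \<psi> K"
  shows "\<psi> s \<le> 1"
proof -
  have "convex {x. \<psi> x \<le> 1}"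
  proof (rule convexI)
    fix x y and u v :: real
    assume *: "x \<in> {x. \<psi> x \<le> 1}" "y \<in> {x. \<psi> x \<le> 1}" "0 \<le> u" "0 \<le> v" "u + v = 1"
    have "\<psi> (u *\<^sub>R x + v *\<^sub>R y) \<le> u * \<psi> x + v * \<psi> y"
      using seminorm_add[OF assms(1), of "u *\<^sub>R x" "v *\<^sub>R y"] * assms(1)
      by (simp add: seminorm_scaleR)
    also have "\<dots> \<le> 1"
      using * by (intro convex_bound_le) auto
    finally show "u *\<^sub>R x + v *\<^sub>R y \<in> {x. \<psi> x \<le> 1}" by simp
  qed
  then have "S_neg \<psi> K \<subseteq> {x. \<psi> x \<le> 1}"
    unfolding S_neg_def
    using assms(1) by (intro hull_minimal) (auto simp: normlike_base_def seminorm_minus)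
  with assms(2) show ?thesis by blast
qed

text \<open>The point lies on the segment from 0 to the base point x / \<psi> x, at parameter \<psi>
  x / c \<le> 1.\<close>

lemma scaleR_in_S_zero:
  assumes "is_seminorm \<psi>" "convex_cone A" "x \<in> A" "0 < \<psi> x" "\<psi> x \<le> c"
  shows "(1 / c) *\<^sub>R x \<in> S_zero \<psi> A"
proof -
  have "(1 / \<psi> x) *\<^sub>R x \<in> normlike_base \<psi> A"
    using assms by (simp add: normlike_base_def seminorm_scaleR convex_cone_scaleR)
  then have "(1 - \<psi> x / c) *\<^sub>R 0 + (\<psi> x / c) *\<^sub>R ((1 / \<psi> x) *\<^sub>R x) \<in> S_zero \<psi> A"
    unfolding S_zero_def using assms
    by (intro convexD_alt convex_convex_hull hull_inc) auto
  then show ?thesis using assms by simp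
qed

text \<open>The bound \<psi> x \<le> c serves to place the same multiple in \<open>S_zero\<close>
  when \<open>x\<close> is a nonzero point of \<open>A\<close>.\<close>

lemma interior_cone_scaled_in_interior_S_neg:
  fixes K :: "'a::real_topological_vector set"
  assumes \<psi>: "is_seminorm \<psi>" and K: "convex_cone K" "\<And>k. k \<in> K - {0} \<Longrightarrow> \<psi> k > 0"
    and "solid (S_neg \<psi> K)" and x: "x \<in> interior (uminus ` K)"
  obtains c where "0 < c" "\<psi> x \<le> c" "(1 / c) *\<^sub>R x \<in> interior (S_neg \<psi> K)"
proof -
  obtain s where s: "s \<in> interior (S_neg \<psi> K)"
    using assms(4) by (auto simp: solid_def)
  then have s1: "\<psi> s \<le> 1"
    using seminorm_S_neg_le_1[OF \<psi>] interior_subset by blast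
  obtain r where r: "r > 0" "x + r *\<^sub>R (- s) \<in> uminus ` K"
    using interior_absorbing[OF x] by blast
  then obtain k where k: "k \<in> K" "x = - k + r *\<^sub>R s"
    by (auto simp: algebra_simps)
  have "\<psi> x \<le> \<psi> k + r * \<psi> s"
    using seminorm_add[OF \<psi>, of "- k" "r *\<^sub>R s"] k r \<psi>
    by (simp add: seminorm_scaleR seminorm_minus)
  also have "\<dots> \<le> \<psi> k + r"
    using s1 r by (simp add: mult_left_le)
  finally have le: "\<psi> x \<le> \<psi> k + r" .
  show thesis
  proof (cases "k = 0")
    \<comment> \<open>Here \<open>k\<close> cannot be normalised, but x = r s, so dividing by r
      already gives the interior point \<open>s\<close>.\<close>
    case True
    moreover from this have "\<psi> k = 0"
      using seminorm_scaleR[OF \<psi>, of 0 0] by simp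
    ultimately show thesis
      using that[of r] r k le s by simp
  next
    case False
    then have k0: "\<psi> k > 0" using k K(2) by blast
    define c where "c = \<psi> k + r"
    have c: "0 < c" using k0 r by (simp add: c_def)
    have "(1 / \<psi> k) *\<^sub>R k \<in> normlike_base \<psi> K"
      using k k0 K \<psi> by (simp add: normlike_base_def seminorm_scaleR convex_cone_scaleR)
    then have "- ((1 / \<psi> k) *\<^sub>R k) \<in> S_neg \<psi> K"
      unfolding S_neg_def by (intro hull_inc) blast
    \<comment> \<open>The weights sum to 1 and the interior point \<open>s\<close> has positive
      weight, so the combination is interior.\<close>
    then have "(\<psi> k / c) *\<^sub>R (- ((1 / \<psi> k) *\<^sub>R k)) + (r / c) *\<^sub>R s \<in> interior (S_neg \<psi> K)"
      using s k0 r c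
      by (intro convex_interior_combination)
         (auto simp: S_neg_def c_def add_divide_distrib[symmetric])
    moreover have "(\<psi> k / c) *\<^sub>R (- ((1 / \<psi> k) *\<^sub>R k)) + (r / c) *\<^sub>R s = (1 / c) *\<^sub>R x"
      unfolding k(2) using k0 by (simp add: scaleR_diff_right)
    ultimately show thesis
      using that[of c] c le by (simp add: c_def)
  qed
qed

section \<open>Equivalence of the disjointness and separation conditions\<close>

theorem theorem5p8:
  fixes \<psi> :: "'a::real_topological_vector \<Rightarrow> real"
    and K A :: "'a set"
  assumes "(UNIV :: 'a set) \<noteq> {0}"
    and "is_seminorm \<psi>"
    and "nontrivial_cone K" and "convex K" and "has_normlike_base \<psi> K"
    and "nontrivial_cone A" and "convex A" and "has_normlike_base \<psi> A"
    and "solid K"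
    and "solid (S_neg \<psi> K)"
  defines "P1 \<equiv> S_zero \<psi> A \<inter> interior (S_neg \<psi> K) = {}"
    and "P2 \<equiv> A \<inter> interior (uminus ` K) = {}"
    and "P3 \<equiv> \<exists>f \<in> top_dual_cone K - {\<lambda>_. 0}.
           \<forall>a\<in>A. \<forall>k\<in>interior (uminus ` K). f a \<ge> 0 \<and> 0 > f k"
    and "P4 \<equiv> \<exists>(f, \<alpha>) \<in> top_aug_dual_cone \<psi> K.
           \<forall>a\<in>A. \<forall>k\<in>interior (uminus ` K).
             f a + \<alpha> * \<psi> a \<ge> 0 \<and> 0 > f k + \<alpha> * \<psi> k"
  shows "(P1 \<longleftrightarrow> P2) \<and> (P2 \<longleftrightarrow> P3) \<and> (P3 \<longleftrightarrow> P4)"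
proof -
  have K: "convex_cone K" and A: "convex_cone A"
    using assms by (auto simp: nontrivial_cone_def is_cone_convex_cone)
  have K0: "0 \<in> K" and A0: "0 \<in> A"
    using K A convex_cone_contains_0 by auto
  have \<psi>K: "\<psi> k > 0" if "k \<in> K - {0}" for k
    using assms(5) that by (simp add: has_normlike_base_def)
  have \<psi>A: "\<psi> a > 0" if "a \<in> A - {0}" for a
    using assms(8) that by (simp add: has_normlike_base_def)
  obtain e where e: "e \<in> interior K"
    using \<open>solid K\<close> by (auto simp: solid_def)
  then have eK: "e \<in> K" using interior_subset by blast
  have "P2 \<Longrightarrow> P1"
    unfolding P1_def P2_def
    using S_zero_subset[OF \<open>convex A\<close> A0, of \<psi>] interior_mono[OF S_neg_subset[OF \<open>convex K\<close>, of \<psi>]]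
    by blast
  moreover have "P1 \<Longrightarrow> P2"
  proof (rule ccontr)
    assume P1 "\<not> P2"
    then obtain x where x: "x \<in> A" "x \<in> interior (uminus ` K)"
      by (auto simp: P2_def)
    \<comment> \<open>The seminorm is known to be positive only off the origin, so
      \<open>x = 0\<close> has to be excluded first.\<close>
    have "K \<noteq> UNIV"
      using assms(3) by (simp add: nontrivial_cone_def)
    then have "x \<noteq> 0"
      using x(2) cone_zero_notin_interior[OF K] by (auto simp: interior_uminus_image)
    then have "\<psi> x > 0" using \<psi>A x by blast
    moreover obtain c where "0 < c" "\<psi> x \<le> c" "(1 / c) *\<^sub>R x \<in> interior (S_neg \<psi> K)"
      using interior_cone_scaled_in_interior_S_neg[OF assms(2) K \<psi>K assms(10) x(2)] by blast
    ultimately have "(1 / c) *\<^sub>R x \<in> S_zero \<psi> A \<inter> interior (S_neg \<psi> K)"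
      using scaleR_in_S_zero[OF assms(2) A x(1)] by blast
    with \<open>P1\<close> show False by (auto simp: P1_def)
  qed
  moreover have "P2 \<Longrightarrow> P3"
  proof -
    assume P2
    \<comment> \<open>Since \<open>A\<close> and \<open>K\<close> contain 0, both lie in their sum
      \<open>C\<close>; one functional that is nonnegative on \<open>C\<close> therefore serves both
      cones.\<close>
    define C where "C = (\<Union>a\<in>A. \<Union>k\<in>K. {a + k})"
    have sub: "A \<subseteq> C" "K \<subseteq> C"
      using A0 K0 by (force simp: C_def)+
    have "convex_cone C"
      unfolding C_def by (rule convex_cone_sums[OF A K])
    moreover have "e \<in> interior C"
      using e sub interior_mono by blast
    moreover have "- e \<notin> C"
    proof
      assume "- e \<in> C"
      then obtain a k where "a + k = - e" "a \<in> A" "k \<in> K"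
        by (auto simp: C_def)
      \<comment> \<open>Solving for \<open>a\<close> exhibits a point of \<open>A\<close> in the
        interior of -K, since e + k is interior to \<open>K\<close>.\<close>
      moreover from this have "a = - (e + k)"
        using add_diff_cancel_right'[of a k] by simp
      ultimately have "- (e + k) \<in> A" and "- (e + k) \<in> uminus ` interior K"
        using cone_add_interior[OF K e, of k] by blast+
      then show False
        using \<open>P2\<close> by (auto simp: P2_def interior_uminus_image)
    qed
    ultimately obtain f :: "'a \<Rightarrow> real" where f: "linear f" "continuous_on UNIV f" "f e = 1"
      "\<forall>v\<in>C. 0 \<le> f v"
      using convex_cone_positive_functional[of C e] by metis
    have "f \<in> top_dual_cone K - {\<lambda>_. 0}"
      using f sub by (auto simp: top_dual_cone_def dual_cone_def algebraic_dual_def topological_dual_def)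
    moreover have "f k < 0" if k: "k \<in> interior (uminus ` K)" for k
    proof -
      obtain x where x: "x \<in> interior K" "k = - x"
        using k by (auto simp: interior_uminus_image)
      have "0 \<le> f v" if "v \<in> K" for v
        using f(4) sub(2) that by blast
      then have "f x > 0"
        using positive_functional_interior[OF f(1) _ _ x(1), of e] f(3) by simp
      then show ?thesis
        using x f(1) by (simp add: linear_neg)
    qed
    ultimately show P3
      unfolding P3_def using f(4) sub by blast
  qed
  moreover have "P3 \<Longrightarrow> P4"
  proof -
    assume P3
    then obtain f :: "'a \<Rightarrow> real" where f: "linear f" "continuous_on UNIV f" "\<And>k. k \<in> K \<Longrightarrow> 0 \<le> f k"
      and sep: "\<forall>a\<in>A. \<forall>k\<in>interior (uminus ` K). f a \<ge> 0 \<and> 0 > f k"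
      by (auto simp: P3_def top_dual_cone_def dual_cone_def topological_dual_def)
    \<comment> \<open>The separation is stated for pairs, so the point 0 of \<open>A\<close> is
      paired with \<open>- e\<close>, which is interior to -K.\<close>
    have "f (- e) < 0"
      using sep A0 e by (auto simp: interior_uminus_image)
    then have fe: "f e > 0" using f by (simp add: linear_neg)
    \<comment> \<open>Membership in the lineality space would make -f nonnegative at
      \<open>e\<close>, against f e > 0.\<close>
    have "f \<notin> lineality (dual_cone K)"
      using fe eK by (force simp: lineality_def dual_cone_def)
    then have "(f, 0) \<in> top_aug_dual_cone \<psi> K"
      using f positive_functional_icor[OF f(1) fe eK K0 f(3)]
      by (auto simp: top_aug_dual_cone_def aug_dual_cone_def dual_cone_def algebraic_dual_def
          topological_dual_def)
    with sep show P4
      unfolding P4_def by (intro bexI[of _ "(f, 0)"]) auto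
  qed
  \<comment> \<open>At a common point of the two sets the same value would be both nonnegative and
    negative.\<close>
  moreover have "P4 \<Longrightarrow> P2"
    unfolding P4_def P2_def by fastforce
  ultimately show ?thesis by blast
qed

end
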